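(* Let $X$ be a real WLD Banach space satisfying the following condition (d-d): for every closed subspace $Y\subset X$ with $\operatorname{dens}(Y)<\operatorname{dens}(X)$ there is a closed subspace $Z\subset X$ with $Z\subset\Psi(Y^\perp)$ and $\operatorname{codens}(Z)\le\operatorname{dens}(Y)$. Let $\kappa$ be an uncountable regular cardinal and suppose that $\{y_\alpha\}_{\alpha<\kappa}$ is a strongly dispersed sequence in the unit sphere of $X$. Then there exists a subsequence $\{y_{\alpha_\gamma}\}_{\gamma<\kappa}$ which is a bimonotone basic sequence.
   Context: $[\,\cdot\,]$ denotes closed linear span, $\operatorname{codens}(Z)=\operatorname{dens}(X/Z)$, and $Y^\perp\subset X^*$ is the annihilator. For $U\subset X^*$, $\Psi(U)=\{x\in X:\sup_{f\in U\setminus\{0\}}|f(x)|/\|f\|=\|x\|\}$, $\Psi(\emptyset)=\Psi(\{0\})=\{0\}$. A sequence $\{y_\alpha\}_{\alpha<\kappa}$ is strongly dispersed (SD) if $\bigcap_{\nu<\kappa}[y_\alpha:\nu<\alpha<\kappa]=\{0\}$. $X$ is WLD (Weakly Lindelöf Determined) iff it admits a Markushevich basis and has Corson's property (C); equivalently, it has a Markushevich basis $\{(x_\alpha,g_\alpha)\}$ with $\{\alpha:f(x_\alpha)\ne0\}$ countable for every $f\in X^*$. (Markushevich basis: a biorthogonal system whose vectors have dense linear span in $X$ and whose functionals have $w^*$-dense linear span in $X^*$. Property (C): for any $\Gamma\subset X^*$ and $f\in\overline{\Gamma}^{w^*}$ there is a countable $\Gamma_0\subset\Gamma$ with $f\in\overline{\mathrm{conv}}^{w^*}(\Gamma_0)$.)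 Subsequences are given by strictly increasing maps. A sequence $\{x_\gamma\}_{\gamma<\kappa}$ of nonzero vectors is a bimonotone basic sequence if $\|y\|\le\|y+z\|$ and $\|z\|\le\|y+z\|$ for all $\eta<\kappa$, $y\in[x_\gamma:\gamma<\eta]$, $z\in[x_\gamma:\eta\le\gamma<\kappa]$. *)

theory Defs
  imports "HOL-Analysis.Analysis"
begin

unbundle cardinal_syntax

definition dense_in :: "'b topology \<Rightarrow> 'b set \<Rightarrow> bool" where
  "dense_in T D \<longleftrightarrow> D \<subseteq> topspace T \<and> T closure_of D = topspace T"

definition dens :: "'b topology \<Rightarrow> 'b rel" where
  "dens T = |SOME D. dense_in T D \<and> (\<forall>E. dense_in T E \<longrightarrow> |D| \<le>o |E| )|"

lemma dens_attained:
  obtains D where "dense_in T D" "dens T = |D|" "\<And>E. dense_in T E \<Longrightarrow> dens T \<le>o |E|"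
proof -
  have "card_of ` {D. dense_in T D} \<noteq> {}"
    using closure_of_topspace[of T] by (auto simp: dense_in_def)
  then have "\<exists>D. dense_in T D \<and> (\<forall>E. dense_in T E \<longrightarrow> |D| \<le>o |E| )"
    using exists_minim_Card_order[of "card_of ` {D. dense_in T D}"] card_of_Card_order by blast
  from someI_ex[OF this] show thesis
    using that unfolding dens_def by blast
qed

text \<open>The quotient \<open>X/Z\<close> is represented by the set of cosets of \<open>Z\<close>. For two cosets,
  \<^const>\<open>setdist\<close> is the distance given by the quotient norm
  (see \<open>setdist_cosets\<close> below).\<close>

definition cosets :: "'a::real_normed_vector set \<Rightarrow> 'a set set" where
  "cosets Z = range (\<lambda>x. (+) x ` Z)"

definition quotient_topology :: "'a::real_normed_vector set \<Rightarrow> 'a set topology" where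
  "quotient_topology Z = Metric_space.mtopology (cosets Z) setdist"

definition codens :: "'a::real_normed_vector set \<Rightarrow> 'a set rel" where
  "codens Z = dens (quotient_topology Z)"

lemma setdist_cosets:
  fixes Z :: "'a::real_normed_vector set"
  assumes "subspace Z"
  shows "setdist ((+) x ` Z) ((+) y ` Z) = Inf (norm ` ((+) (x - y) ` Z))"
proof -
  have ne: "Z \<noteq> {}"
    using subspace_0[OF assms] by blast
  have "{dist u v |u v. u \<in> (+) x ` Z \<and> v \<in> (+) y ` Z} = norm ` ((+) (x - y) ` Z)" (is "?L = ?R")
  proof
    show "?L \<subseteq> ?R"
    proof
      fix t assume "t \<in> ?L"
      then obtain a b where ab: "a \<in> Z" "b \<in> Z" "t = dist (x + a) (y + b)" by blast
      have "t = norm ((x - y) + (a - b))"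
        by (simp add: ab(3) dist_norm algebra_simps)
      then show "t \<in> ?R"
        using subspace_diff[OF assms ab(1,2)] by blast
    qed
    show "?R \<subseteq> ?L"
    proof
      fix t assume "t \<in> ?R"
      then obtain a where a: "a \<in> Z" "t = norm ((x - y) + a)" by blast
      have "t = dist (x + a) (y + 0)"
        by (simp add: a(2) dist_norm algebra_simps)
      then show "t \<in> ?L"
        using a(1) subspace_0[OF assms] by blast
    qed
  qed
  then show ?thesis
    using ne by (simp add: setdist_def)
qed

lemma Metric_space_cosets:
  fixes Z :: "'a::real_normed_vector set"
  assumes "subspace Z" "closed Z"
  shows "Metric_space (cosets Z) setdist"
proof
  have ne: "Z \<noteq> {}"
    using subspace_0[OF assms(1)] by blast
  have eq: "setdist ((+) x ` Z) ((+) y ` Z) = infdist (x - y) Z" for x y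
  proof -
    have "norm ` ((+) (x - y) ` Z) = dist (x - y) ` Z"
    proof -
      have "(+) (x - y) ` Z = (\<lambda>z. (x - y) - z) ` Z"
      proof -
        have "(\<lambda>z. - z) ` Z = Z"
          using subspace_neg[OF assms(1)] by force
        then have "(+) (x - y) ` Z = (+) (x - y) ` ((\<lambda>z. - z) ` Z)" by simp
        then show ?thesis by (simp add: image_image)
      qed
      then show ?thesis by (simp add: image_image dist_norm)
    qed
    then show ?thesis
      by (simp add: setdist_cosets[OF assms(1)] infdist_def ne)
  qed
  fix C D E :: "'a set"
  show "0 \<le> setdist C D" by (rule setdist_pos_le)
  show "setdist C D = setdist D C" by (rule setdist_sym)
  assume C: "C \<in> cosets Z" and D: "D \<in> cosets Z"
  from C obtain x where x: "C = (+) x ` Z" by (auto simp: cosets_def)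
  from D obtain y where y: "D = (+) y ` Z" by (auto simp: cosets_def)
  show "setdist C D = 0 \<longleftrightarrow> C = D"
  proof
    assume "setdist C D = 0"
    then have xy: "x - y \<in> Z"
      using in_closed_iff_infdist_zero[OF assms(2) ne] eq x y by simp
    show "C = D"
    proof
      have "x + z \<in> D" if "z \<in> Z" for z
        using subspace_add[OF assms(1) xy that] unfolding y
        by (intro image_eqI[of _ _ "(x - y) + z"]) auto
      then show "C \<subseteq> D" by (auto simp: x)
      have "y + z \<in> C" if "z \<in> Z" for z
        using subspace_diff[OF assms(1) that xy] unfolding x
        by (intro image_eqI[of _ _ "z - (x - y)"]) auto
      then show "D \<subseteq> C" by (auto simp: y)
    qed
  next
    assume "C = D"
    then show "setdist C D = 0" using eq[of x x] subspace_0[OF assms(1)] x by simp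
  qed
  assume E: "E \<in> cosets Z"
  from E obtain w where w: "E = (+) w ` Z" by (auto simp: cosets_def)
  show "setdist C E \<le> setdist C D + setdist D E"
  proof (rule field_le_epsilon)
    fix e :: real assume e: "0 < e"
    have bd: "\<exists>a\<in>Z. dist (u - v) a < infdist (u - v) Z + e/2" for u v :: 'a
    proof (rule ccontr)
      assume "\<not> ?thesis"
      then have "infdist (u - v) Z + e/2 \<le> infdist (u - v) Z"
        unfolding infdist_notempty[OF ne] by (intro cINF_greatest ne) (auto simp: not_less)
      then show False using e by simp
    qed
    obtain a where a: "a \<in> Z" "dist (x - y) a < infdist (x - y) Z + e/2" using bd by blast
    obtain b where b: "b \<in> Z" "dist (y - w) b < infdist (y - w) Z + e/2" using bd by blast
    have "infdist (x - w) Z \<le> dist (x - w) (a + b)"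
      by (intro infdist_le subspace_add assms a b)
    also have "\<dots> \<le> dist (x - y) a + dist (y - w) b"
      unfolding dist_norm by (rule order_trans[OF _ norm_triangle_ineq]) (simp add: algebra_simps)
    finally show "setdist C E \<le> setdist C D + setdist D E + e"
      using a b by (simp add: x y w eq)
  qed
qed

text \<open>\<open>X\<^sup>*\<close> is the type of bounded linear maps into the reals. Their strong operator topology,
  the topology of pointwise convergence, is the weak-star topology of \<open>X\<^sup>*\<close>.\<close>

abbreviation weak_star_topology :: "('a::real_normed_vector \<Rightarrow>\<^sub>L real) topology" where
  "weak_star_topology \<equiv> strong_operator_topology"

definition annihilator :: "'a::real_normed_vector set \<Rightarrow> ('a \<Rightarrow>\<^sub>L real) set" where
  "annihilator Y = {f. \<forall>y\<in>Y. blinfun_apply f y = 0}"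

definition Psi :: "('a::real_normed_vector \<Rightarrow>\<^sub>L real) set \<Rightarrow> 'a set" where
  "Psi U = (if U \<subseteq> {0} then {0}
     else {x. (SUP f\<in>U - {0}. \<bar>blinfun_apply f x\<bar> / norm f) = norm x})"

definition closed_span :: "'a::real_normed_vector set \<Rightarrow> 'a set" where
  "closed_span S = closure (span S)"

definition markushevich_basis ::
  "'i set \<Rightarrow> ('i \<Rightarrow> 'a::real_normed_vector) \<Rightarrow> ('i \<Rightarrow> ('a \<Rightarrow>\<^sub>L real)) \<Rightarrow> bool" where
  "markushevich_basis I x g \<longleftrightarrow>
     (\<forall>\<alpha>\<in>I. \<forall>\<beta>\<in>I. blinfun_apply (g \<alpha>) (x \<beta>) = (if \<alpha> = \<beta> then 1 else 0)) \<and>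
     closed_span (x ` I) = UNIV \<and>
     weak_star_topology closure_of span (g ` I) = UNIV"

definition property_C :: "'a::real_normed_vector itself \<Rightarrow> bool" where
  "property_C TYPE_X \<longleftrightarrow>
     (\<forall>(\<Gamma> :: ('a \<Rightarrow>\<^sub>L real) set) f. f \<in> weak_star_topology closure_of \<Gamma> \<longrightarrow>
        (\<exists>\<Gamma>\<^sub>0\<subseteq>\<Gamma>. countable \<Gamma>\<^sub>0 \<and> f \<in> weak_star_topology closure_of (convex hull \<Gamma>\<^sub>0)))"

text \<open>The vectors of a biorthogonal system are pairwise distinct, so every Markushevich basis of
  \<open>X\<close> can be reindexed by a subset of \<open>X\<close>; hence index sets in \<open>'a\<close> lose no generality.\<close>

definition WLD :: "'a::banach itself \<Rightarrow> bool" where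
  "WLD TYPE_X \<longleftrightarrow>
     (\<exists>(I :: 'a set) (x :: 'a \<Rightarrow> 'a) g. markushevich_basis I x g) \<and> property_C TYPE_X"

definition condition_dd :: "'a::banach itself \<Rightarrow> bool" where
  "condition_dd TYPE_X \<longleftrightarrow>
     (\<forall>Y :: 'a set. closed Y \<and> subspace Y \<and> dens (top_of_set Y) <o dens (euclidean :: 'a topology) \<longrightarrow>
        (\<exists>Z. closed Z \<and> subspace Z \<and> Z \<subseteq> Psi (annihilator Y) \<and>
             codens Z \<le>o dens (top_of_set Y)))"

text \<open>A cardinal \<open>\<kappa>\<close> is given as a well-order relation; a sequence of length \<open>\<kappa>\<close> is a function
  on \<^term>\<open>Field \<kappa>\<close>, and its values elsewhere are irrelevant.\<close>

definition strongly_dispersed :: "'i rel \<Rightarrow> ('i \<Rightarrow> 'a::real_normed_vector) \<Rightarrow> bool" where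
  "strongly_dispersed \<kappa> y \<longleftrightarrow> (\<Inter>\<nu>\<in>Field \<kappa>. closed_span (y ` aboveS \<kappa> \<nu>)) = {0}"

definition strictly_increasing :: "'i rel \<Rightarrow> ('i \<Rightarrow> 'i) \<Rightarrow> bool" where
  "strictly_increasing \<kappa> a \<longleftrightarrow> a \<in> Field \<kappa> \<rightarrow> Field \<kappa> \<and>
     monotone_on (Field \<kappa>) (\<lambda>\<gamma> \<delta>. (\<gamma>, \<delta>) \<in> \<kappa> - Id) (\<lambda>\<gamma> \<delta>. (\<gamma>, \<delta>) \<in> \<kappa> - Id) a"

definition bimonotone_basic :: "'i rel \<Rightarrow> ('i \<Rightarrow> 'a::real_normed_vector) \<Rightarrow> bool" where
  "bimonotone_basic \<kappa> x \<longleftrightarrow>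
     (\<forall>\<gamma>\<in>Field \<kappa>. x \<gamma> \<noteq> 0) \<and>
     (\<forall>\<eta>\<in>Field \<kappa>. \<forall>y\<in>closed_span (x ` underS \<kappa> \<eta>). \<forall>z\<in>closed_span (x ` above \<kappa> \<eta>).
        norm y \<le> norm (y + z) \<and> norm z \<le> norm (y + z))"

end

theory Submission
  imports Defs
begin

text \<open>The idea is that every functional vanishes on a tail of a strongly dispersed sequence, hence by
  regularity so does any family of fewer than \<open>\<kappa>\<close> functionals. Applied to norming functionals for a
  dense subset, this gives \<open>dens X \<ge> \<kappa>\<close>, so that condition (d-d) is available for the closed span
  \<open>Y\<close> of any fewer than \<open>\<kappa>\<close> terms. A tail \<open>T\<close> annihilated by norming functionals of a dense subset
  of \<open>Y\<close> satisfies \<open>\<parallel>u\<parallel> \<le> \<parallel>u + z\<parallel>\<close> for \<open>u \<in> Y\<close> and \<open>z \<in> T\<close>. The subspace \<open>Z \<subseteq> \<Psi>(Y\<^sup>\<bottom>)\<close> from (d-d) is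
  the common kernel of fewer than \<open>\<kappa>\<close> functionals, so it contains a tail, and membership in
  \<open>\<Psi>(Y\<^sup>\<bottom>)\<close> gives \<open>\<parallel>z\<parallel> \<le> \<parallel>u + z\<parallel>\<close>. The subsequence is then chosen by transfinite recursion.\<close>

subsection \<open>The Hahn-Banach theorem\<close>

text \<open>Homogeneity is asked only as an inequality for \<open>c > 0\<close>, the form that
  infima inherit easily; equality follows on scaling back by \<open>1/c\<close>.\<close>

definition sublinear :: "('a::real_vector \<Rightarrow> real) \<Rightarrow> bool" where
  "sublinear p \<longleftrightarrow> (\<forall>x y. p (x + y) \<le> p x + p y) \<and> (\<forall>c>0. \<forall>x. p (c *\<^sub>R x) \<le> c * p x)"

lemma sublinear_add: "sublinear p \<Longrightarrow> p (x + y) \<le> p x + p y"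
  and sublinear_scaleR_le: "sublinear p \<Longrightarrow> c > 0 \<Longrightarrow> p (c *\<^sub>R x) \<le> c * p x"
  by (auto simp: sublinear_def)

lemma sublinear_0 [simp]:
  assumes "sublinear p"
  shows "p 0 = 0"
  using sublinear_scaleR_le[OF assms, of 2 0] sublinear_scaleR_le[OF assms, of "1/2" 0] by simp

lemma sublinear_scaleR:
  assumes "sublinear p" "c \<ge> 0"
  shows "p (c *\<^sub>R x) = c * p x"
proof (cases "c = 0")
  case False
  with assms have c: "c > 0" by simp
  have "p ((1/c) *\<^sub>R (c *\<^sub>R x)) \<le> (1/c) * p (c *\<^sub>R x)"
    using c by (intro sublinear_scaleR_le assms) auto
  then have "c * p x \<le> p (c *\<^sub>R x)"
    using c by (simp add: field_simps)
  with sublinear_scaleR_le[OF assms(1) c, of x] show ?thesis by simp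
qed (use assms in simp)

lemma sublinear_minus: "sublinear p \<Longrightarrow> - p (- x) \<le> p x"
  using sublinear_add[of p x "- x"] by simp

text \<open>The conditions couple different indices, so that one lemma serves a real parameter, a
  chain of functionals and the distance to a subspace.\<close>

lemma sublinear_INF:
  fixes F :: "'i \<Rightarrow> 'a::real_vector \<Rightarrow> real"
  assumes ne: "I \<noteq> {}"
    and bdd: "\<And>x. bdd_below ((\<lambda>i. F i x) ` I)"
    and add: "\<And>i j x y. i \<in> I \<Longrightarrow> j \<in> I \<Longrightarrow> \<exists>k\<in>I. F k (x + y) \<le> F i x + F j y"
    and scale: "\<And>i c x. i \<in> I \<Longrightarrow> c > 0 \<Longrightarrow> \<exists>k\<in>I. F k (c *\<^sub>R x) \<le> c * F i x"
  shows "sublinear (\<lambda>x. INF i\<in>I. F i x)"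
proof -
  let ?u = "\<lambda>x. INF i\<in>I. F i x"
  have low: "?u x \<le> F i x" if "i \<in> I" for i x
    using bdd that by (rule cINF_lower)
  have "?u (x + y) \<le> ?u x + ?u y" for x y
  proof -
    have *: "?u (x + y) - F j y \<le> ?u x" if j: "j \<in> I" for j
    proof (rule cINF_greatest[OF ne])
      fix i assume "i \<in> I"
      with add[OF this j, of x y] low[of _ "x + y"] show "?u (x + y) - F j y \<le> F i x"
        by fastforce
    qed
    have "?u (x + y) - ?u x \<le> ?u y"
      using * by (intro cINF_greatest[OF ne]) (simp add: algebra_simps)
    then show ?thesis by simp
  qed
  moreover have "?u (c *\<^sub>R x) \<le> c * ?u x" if c: "c > 0" for c x
  proof -
    have "?u (c *\<^sub>R x) / c \<le> ?u x"
    proof (rule cINF_greatest[OF ne])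
      fix i assume "i \<in> I"
      with scale[OF this c, of x] low[of _ "c *\<^sub>R x"] have "?u (c *\<^sub>R x) \<le> c * F i x"
        by fastforce
      with c show "?u (c *\<^sub>R x) / c \<le> F i x" by (simp add: field_simps)
    qed
    with c show ?thesis by (simp add: field_simps)
  qed
  ultimately show ?thesis unfolding sublinear_def by blast
qed

text \<open>In the infimum \<open>?r\<close>, the parameter \<open>t = 0\<close> gives
  \<open>r y \<le> q y\<close>, and \<open>t = 1\<close> at \<open>- x\<close> gives the last bound.
  The lemma serves to test minimality and to fix a value in Hahn-Banach.\<close>

lemma sublinear_decrease:
  assumes q: "sublinear q"
  obtains r where "sublinear r" "\<And>y. r y \<le> q y" "r (- x) \<le> - q x"
proof
  let ?F = "\<lambda>t y. q (y + t *\<^sub>R x) - t * q x"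
  let ?r = "\<lambda>y. INF t\<in>{0..}. ?F t y"
  \<comment> \<open>Subadditivity gives \<open>t * q x = q (t *\<^sub>R x) \<le> q (- y) + q (y + t
    *\<^sub>R x)\<close>, a bound independent of \<open>t\<close>.\<close>
  have bdd: "bdd_below ((\<lambda>t. ?F t y) ` {0..})" for y
  proof (rule bdd_belowI2)
    fix t :: real assume "t \<in> {0..}"
    then show "- q (- y) \<le> ?F t y"
      using sublinear_add[OF q, of "- y" "y + t *\<^sub>R x"] sublinear_scaleR[OF q, of t x] by simp
  qed
  show "sublinear ?r"
  proof (rule sublinear_INF)
    fix s t :: real and y z :: 'a assume "s \<in> {0..}" "t \<in> {0..}"
    moreover have "?F (s + t) (y + z) \<le> ?F s y + ?F t z"
      using sublinear_add[OF q, of "y + s *\<^sub>R x" "z + t *\<^sub>R x"] by (simp add: algebra_simps)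
    ultimately show "\<exists>k\<in>{0..}. ?F k (y + z) \<le> ?F s y + ?F t z"
      by (intro bexI[of _ "s + t"]) auto
  next
    fix t c :: real and y :: 'a assume "t \<in> {0..}" "c > 0"
    moreover have "?F (c * t) (c *\<^sub>R y) \<le> c * ?F t y"
      using sublinear_scaleR_le[OF q \<open>c > 0\<close>, of "y + t *\<^sub>R x"] by (simp add: algebra_simps)
    ultimately show "\<exists>k\<in>{0..}. ?F k (c *\<^sub>R y) \<le> c * ?F t y"
      by (intro bexI[of _ "c * t"]) auto
  qed (use bdd in auto)
  show "?r y \<le> q y" for y
    using cINF_lower[OF bdd, of 0 y] by simp
  show "?r (- x) \<le> - q x"
    using cINF_lower[OF bdd, of 1 "- x"] q by simp
qed

text \<open>Zorn's lemma for the reversed pointwise order. The infimum of a nonempty chain is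
  sublinear because the smaller of two members can replace the other, and finite because
  \<open>- p (- x)\<close> bounds all members from below.\<close>

lemma minimal_sublinear_ex:
  fixes p :: "'a::real_vector \<Rightarrow> real"
  assumes p: "sublinear p"
  obtains q where "sublinear q" "\<And>x. q x \<le> p x"
    "\<And>r. sublinear r \<Longrightarrow> (\<And>x. r x \<le> q x) \<Longrightarrow> r = q"
proof -
  let ?A = "{q. sublinear q \<and> q \<le> p}"
  let ?P = "\<lambda>q r :: 'a \<Rightarrow> real. r \<le> q"
  have "\<exists>m\<in>?A. \<forall>a\<in>?A. ?P m a \<longrightarrow> a = m"
  proof (rule predicate_Zorn)
    show "partial_order_on ?A (relation_of ?P ?A)"
      by (rule partial_order_on_relation_ofI) auto
    fix C assume C: "C \<in> Chains (relation_of ?P ?A)"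
    then have CA: "C \<subseteq> ?A" by (auto simp: Chains_def relation_of_def)
    have tot: "q \<le> r \<or> r \<le> q" if "q \<in> C" "r \<in> C" for q r
      using C that by (auto simp: Chains_def relation_of_def)
    show "\<exists>u\<in>?A. \<forall>a\<in>C. ?P a u"
    proof (cases "C = {}")
      case True
      with p show ?thesis by auto
    next
      case False
      let ?u = "\<lambda>x. INF q\<in>C. q x"
      have bdd: "bdd_below ((\<lambda>q. q x) ` C)" for x
      proof (rule bdd_belowI2)
        fix q assume "q \<in> C"
        with CA have "sublinear q" "q (- x) \<le> p (- x)" by (auto simp: le_fun_def)
        then show "- p (- x) \<le> q x" using sublinear_minus[of q x] by linarith
      qed
      have "sublinear ?u"
      proof (rule sublinear_INF[OF False bdd])
        fix q r x y assume qr: "q \<in> C" "r \<in> C"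
        then have "sublinear q" "sublinear r" using CA by auto
        with tot[OF qr] have "q (x + y) \<le> q x + r y \<or> r (x + y) \<le> q x + r y"
          using sublinear_add[of q x y] sublinear_add[of r x y]
            le_funD[of q r y] le_funD[of r q x] by (smt (verit))
        with qr show "\<exists>k\<in>C. k (x + y) \<le> q x + r y" by blast
      next
        fix q x and c :: real assume "q \<in> C" "c > 0"
        then show "\<exists>k\<in>C. k (c *\<^sub>R x) \<le> c * q x"
          using CA by (intro bexI[of _ q] sublinear_scaleR_le) auto
      qed
      moreover have low: "?u \<le> q" if "q \<in> C" for q
        using cINF_lower[OF bdd that] by (auto simp: le_fun_def)
      moreover have "?u \<le> p"
      proof -
        obtain q where "q \<in> C" using False by blast
        with low[OF this] CA show ?thesis by (blast intro: order_trans)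
      qed
      ultimately show ?thesis by blast
    qed
  qed
  then obtain m where m: "m \<in> ?A" "\<And>a. a \<in> ?A \<Longrightarrow> a \<le> m \<Longrightarrow> a = m" by blast
  show thesis
  proof (rule that)
    fix r assume "sublinear r" "\<And>x. r x \<le> m x"
    then show "r = m"
      using m by (intro m(2)) (auto simp: le_fun_def intro: order_trans[of "r _" "m _"])
  qed (use m(1) in \<open>auto simp: le_fun_def\<close>)
qed

text \<open>Minimality identifies \<open>q\<close> with the functional from
  \<open>sublinear_decrease\<close>, so \<open>q\<close> is odd. Oddness reverses subadditivity and
  extends homogeneity to negative scalars.\<close>

lemma linear_if_minimal_sublinear:
  assumes q: "sublinear q" and min: "\<And>r. sublinear r \<Longrightarrow> (\<And>x. r x \<le> q x) \<Longrightarrow> r = q"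
  shows "linear q"
proof -
  have neg: "q (- x) = - q x" for x
  proof -
    obtain r where r: "sublinear r" "\<And>y. r y \<le> q y" "r (- x) \<le> - q x"
      using sublinear_decrease[OF q] by blast
    with min[OF r(1,2)] sublinear_minus[OF q, of "- x"] show ?thesis by simp
  qed
  show ?thesis
  proof
    show "q (x + y) = q x + q y" for x y
      using sublinear_add[OF q, of x y] sublinear_add[OF q, of "- x" "- y"] neg[of "x + y"]
      by (simp add: neg)
    show "q (c *\<^sub>R x) = c *\<^sub>R q x" for c x
      using sublinear_scaleR[OF q, of c x] sublinear_scaleR[OF q, of "- c" x] neg[of "c *\<^sub>R x"]
      by (cases "c \<ge> 0") auto
  qed
qed

text \<open>Lowering \<open>p\<close> to \<open>p'\<close> with \<open>p' (- a) \<le> - p a\<close>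
  before minimising forces every linear \<open>f\<close> below \<open>p'\<close> to satisfy
  \<open>f a \<ge> p a\<close>.\<close>

theorem Hahn_Banach_sublinear:
  assumes p: "sublinear p"
  obtains f where "linear f" "\<And>x. f x \<le> p x" "f a = p a"
proof -
  obtain p' where p': "sublinear p'" "\<And>x. p' x \<le> p x" "p' (- a) \<le> - p a"
    using sublinear_decrease[OF p] by blast
  obtain f where f: "sublinear f" "\<And>x. f x \<le> p' x"
    "\<And>r. sublinear r \<Longrightarrow> (\<And>x. r x \<le> f x) \<Longrightarrow> r = f"
    using minimal_sublinear_ex[OF p'(1)] by blast
  have lin: "linear f" using linear_if_minimal_sublinear f by blast
  have "f (- a) \<le> - p a" using f(2) p'(3) order_trans by blast
  then have "p a \<le> f a" using linear_neg[OF lin, of a] by simp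
  moreover have le: "f x \<le> p x" for x using f(2) p'(2) order_trans by blast
  ultimately show thesis using that[OF lin le] by (simp add: order.antisym)
qed

section \<open>Functionals dominated by the distance to a subspace\<close>

lemma infdist_subspace_le: "subspace Z \<Longrightarrow> infdist x Z \<le> norm x"
  using infdist_le[OF subspace_0, of Z x] by simp

lemma sublinear_infdist:
  fixes Z :: "'a::real_normed_vector set"
  assumes Z: "subspace Z"
  shows "sublinear (\<lambda>x. infdist x Z)"
proof -
  have ne: "Z \<noteq> {}" using subspace_0[OF Z] by blast
  have "sublinear (\<lambda>x. INF z\<in>Z. dist x z)"
  proof (rule sublinear_INF[OF ne])
    show "bdd_below ((\<lambda>i. dist x i) ` Z)" for x
      by (rule bdd_belowI2[of _ 0]) simp
    fix u v x y assume "u \<in> Z" "v \<in> Z"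
    then show "\<exists>w\<in>Z. dist (x + y) w \<le> dist x u + dist y v"
      by (intro bexI[of _ "u + v"] dist_triangle_add subspace_add[OF Z])
  next
    fix u x and c :: real assume "u \<in> Z" "c > 0"
    then show "\<exists>w\<in>Z. dist (c *\<^sub>R x) w \<le> c * dist x u"
      by (intro bexI[of _ "c *\<^sub>R u"] subspace_scale[OF Z])
        (simp_all add: dist_norm flip: scaleR_diff_right)
  qed
  then show ?thesis by (simp add: infdist_notempty[OF ne])
qed

text \<open>The distance to \<open>Z\<close> is the quotient seminorm: domination by it makes
  \<open>f\<close> vanish on \<open>Z\<close> and have norm at most 1. For \<open>Z = {0}\<close>
  the result is a norming functional of \<open>a\<close>.\<close>

corollary Hahn_Banach_infdist:
  fixes Z :: "'a::real_normed_vector set"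
  assumes Z: "subspace Z"
  obtains f :: "'a \<Rightarrow>\<^sub>L real"
  where "f \<in> annihilator Z" "\<And>x. \<bar>f x\<bar> \<le> infdist x Z" "f a = infdist a Z"
proof -
  have ne: "Z \<noteq> {}" using subspace_0[OF Z] by blast
  obtain f where lin: "linear f" and f: "\<And>x. f x \<le> infdist x Z" "f a = infdist a Z"
    using Hahn_Banach_sublinear[OF sublinear_infdist[OF Z]] by metis
  have "infdist (- x) Z \<le> infdist x Z" for x
    unfolding infdist_notempty[OF ne]
  proof (rule cINF_greatest[OF ne])
    fix z assume "z \<in> Z"
    then show "(INF z\<in>Z. dist (- x) z) \<le> dist x z"
      using infdist_le[OF subspace_neg[OF Z], of z "- x"]
      by (simp add: infdist_notempty[OF ne] dist_minus)
  qed
  then have abs: "\<bar>f x\<bar> \<le> infdist x Z" for x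
    using f(1)[of x] f(1)[of "- x"] linear_neg[OF lin, of x] by (smt (verit))
  have "bounded_linear f"
  proof (rule bounded_linear_intro)
    show "norm (f x) \<le> norm x * 1" for x
      using abs[of x] infdist_subspace_le[OF Z, of x] by simp
  qed (simp_all add: linear_add[OF lin] linear_scale[OF lin])
  then have ap: "blinfun_apply (Blinfun f) = f" by (rule bounded_linear_Blinfun_apply)
  have "Blinfun f \<in> annihilator Z"
    unfolding annihilator_def
  proof (intro CollectI ballI, unfold ap)
    show "f z = 0" if "z \<in> Z" for z
      using abs[of z] infdist_zero[OF that] by simp
  qed
  then show thesis
    by (rule that) (simp_all add: ap abs f)
qed

subsection \<open>Annihilators and weak-star density\<close>

lemma subspace_annihilator: "subspace (annihilator S)"
  by (auto simp: subspace_def annihilator_def blinfun.bilinear_simps)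

lemma annihilator_mono: "S \<subseteq> T \<Longrightarrow> annihilator T \<subseteq> annihilator S"
  by (auto simp: annihilator_def)

lemma annihilator_closed_span [simp]: "annihilator (closed_span S) = annihilator S"
proof
  show "annihilator (closed_span S) \<subseteq> annihilator S"
    using span_superset closure_subset by (intro annihilator_mono) (fastforce simp: closed_span_def)
  show "annihilator S \<subseteq> annihilator (closed_span S)"
  proof
    fix f :: "'a \<Rightarrow>\<^sub>L real" assume f: "f \<in> annihilator S"
    have "subspace {x. f x = 0}" by (auto simp: subspace_def blinfun.bilinear_simps)
    with f have "span S \<subseteq> {x. f x = 0}"
      by (intro span_minimal) (auto simp: annihilator_def)
    moreover have "closed {x. f x = 0}"
      by (intro closed_Collect_eq continuous_intros)
    ultimately show "f \<in> annihilator (closed_span S)"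
      unfolding annihilator_def closed_span_def using closure_minimal by blast
  qed
qed

lemma annihilator_span_eq_0:
  assumes "f \<in> annihilator B" "x \<in> span B"
  shows "blinfun_apply f x = 0"
proof -
  have "f \<in> annihilator (closed_span B)" "x \<in> closed_span B"
    using assms closure_subset[of "span B"] by (auto simp: closed_span_def[of B, symmetric])
  then show ?thesis by (auto simp: annihilator_def simp del: annihilator_closed_span)
qed

lemma closed_span_mono: "S \<subseteq> T \<Longrightarrow> closed_span S \<subseteq> closed_span T"
  unfolding closed_span_def by (intro closure_mono span_mono)

lemma subspace_closed_span: "subspace (closed_span S)"
proof (rule subspaceI)
  show "0 \<in> closed_span S"
    using closure_subset span_zero by (force simp: closed_span_def)
  have "(\<lambda>(x, y). x + y) ` closure (span S \<times> span S) \<subseteq> closure (span S)"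
    using closure_subset span_add
    by (intro image_closure_subset) (force simp: case_prod_unfold intro!: continuous_intros)+
  then show "x + y \<in> closed_span S" if "x \<in> closed_span S" "y \<in> closed_span S" for x y
    using that by (force simp: closed_span_def closure_Times)
  have "(\<lambda>x. c *\<^sub>R x) ` closure (span S) \<subseteq> closure (span S)" for c
    using closure_subset span_scale
    by (intro image_closure_subset) (force intro!: continuous_intros)+
  then show "c *\<^sub>R x \<in> closed_span S" if "x \<in> closed_span S" for c x
    using that by (force simp: closed_span_def)
qed

lemma closed_closed_span: "closed (closed_span S)"
  unfolding closed_span_def by simp

text \<open>Induction on \<open>B\<close>: for a new vector \<open>b\<close> outside the span, some
  \<open>g\<close> vanishes on the old vectors but not at \<open>b\<close>, and subtracting a
  multiple of \<open>g\<close> makes another functional vanish at \<open>b\<close>.\<close>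

lemma separating_subspace_functional:
  fixes \<Gamma> :: "('a::real_normed_vector \<Rightarrow>\<^sub>L real) set"
  assumes \<Gamma>: "subspace \<Gamma>" and sep: "\<And>x. x \<noteq> 0 \<Longrightarrow> \<exists>g\<in>\<Gamma>. blinfun_apply g x \<noteq> 0"
    and "finite B" "x \<notin> span B"
  shows "\<exists>g\<in>\<Gamma>. blinfun_apply g x \<noteq> 0 \<and> g \<in> annihilator B"
  using assms(3,4)
proof (induction B arbitrary: x rule: finite_induct)
  case empty
  then show ?case using sep by (auto simp: annihilator_def)
next
  case (insert b B)
  have x: "x - t *\<^sub>R b \<notin> span B" for t
    using insert.prems by (auto simp: span_insert)
  show ?case
  proof (cases "b \<in> span B")
    case True
    then have "x \<notin> span B" using insert.prems by (simp add: span_redundant)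
    then obtain g where g: "g \<in> \<Gamma>" "g x \<noteq> 0" "g \<in> annihilator B"
      using insert.IH by blast
    with annihilator_span_eq_0[OF g(3) True] have "g \<in> annihilator (insert b B)"
      by (simp add: annihilator_def)
    with g show ?thesis by blast
  next
    case False
    then obtain g where g: "g \<in> \<Gamma>" "g b \<noteq> 0" "g \<in> annihilator B"
      using insert.IH by blast
    \<comment> \<open>The argument of \<open>h\<close> is chosen so that the value of
      \<open>h\<close> there is exactly \<open>?k x\<close>.\<close>
    obtain h where h: "h \<in> \<Gamma>" "h (x - (g x / g b) *\<^sub>R b) \<noteq> 0" "h \<in> annihilator B"
      using insert.IH[OF x] by blast
    let ?k = "h - (h b / g b) *\<^sub>R g"
    have "?k \<in> \<Gamma>" using \<Gamma> g h by (intro subspace_diff subspace_scale)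
    moreover have "?k x \<noteq> 0" "?k \<in> annihilator (insert b B)"
      using g h by (auto simp: annihilator_def blinfun.bilinear_simps)
    ultimately show ?thesis by blast
  qed
qed

text \<open>One point is added at a time: a functional vanishing on the earlier points corrects the
  value at \<open>x\<close>, unless \<open>x\<close> lies in their span and its value is already
  right.\<close>

lemma separating_subspace_interpolates:
  fixes \<Gamma> :: "('a::real_normed_vector \<Rightarrow>\<^sub>L real) set"
  assumes \<Gamma>: "subspace \<Gamma>" and sep: "\<And>x. x \<noteq> 0 \<Longrightarrow> \<exists>g\<in>\<Gamma>. blinfun_apply g x \<noteq> 0"
    and "finite B"
  shows "\<exists>g\<in>\<Gamma>. f - g \<in> annihilator B"
  using \<open>finite B\<close>
proof induction
  case empty
  then show ?case using subspace_0[OF \<Gamma>] by (auto simp: annihilator_def)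
next
  case (insert x B)
  then obtain g where g: "g \<in> \<Gamma>" "f - g \<in> annihilator B" by blast
  show ?case
  proof (cases "x \<in> span B")
    case True
    with g(2) have "(f - g) x = 0" by (rule annihilator_span_eq_0)
    with g show ?thesis by (auto simp: annihilator_def)
  next
    case False
    then obtain h where h: "h \<in> \<Gamma>" "h x \<noteq> 0" "h \<in> annihilator B"
      using separating_subspace_functional[OF \<Gamma> sep insert.hyps(1)] by blast
    have "g + ((f - g) x / h x) *\<^sub>R h \<in> \<Gamma>"
      using \<Gamma> g h by (intro subspace_add subspace_scale)
    moreover have "f - (g + ((f - g) x / h x) *\<^sub>R h) \<in> annihilator (insert x B)"
      using g h by (auto simp: annihilator_def blinfun.bilinear_simps)
    ultimately show ?thesis by blast
  qed
qed

text \<open>A basic weak-star neighbourhood of \<open>f\<close> restricts only finitely many values,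
  and a member of \<open>\<Gamma>\<close> can match those of \<open>f\<close> exactly.\<close>

proposition separating_subspace_weak_star_dense:
  fixes \<Gamma> :: "('a::real_normed_vector \<Rightarrow>\<^sub>L real) set"
  assumes \<Gamma>: "subspace \<Gamma>" and sep: "\<And>x. x \<noteq> 0 \<Longrightarrow> \<exists>g\<in>\<Gamma>. blinfun_apply g x \<noteq> 0"
  shows "weak_star_topology closure_of \<Gamma> = UNIV"
proof -
  have "\<exists>g\<in>\<Gamma>. g \<in> T" if T: "f \<in> T" "openin weak_star_topology T" for f T
  proof -
    obtain U where U: "open U" "T = blinfun_apply -` U"
      using T(2) unfolding strong_operator_topology_def
      by (auto simp: openin_pullback_topology)
    then obtain V where V: "blinfun_apply f \<in> Pi\<^sub>E UNIV V" "finite {x. V x \<noteq> UNIV}" "Pi\<^sub>E UNIV V \<subseteq> U"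
      using product_topology_open_contains_basis[of "\<lambda>_. euclidean" UNIV U "blinfun_apply f"] T(1)
      by (auto simp: open_fun_def)
    obtain g where g: "g \<in> \<Gamma>" "f - g \<in> annihilator {x. V x \<noteq> UNIV}"
      using separating_subspace_interpolates[OF \<Gamma> sep V(2)] by blast
    have "g x \<in> V x" for x
    proof (cases "V x = UNIV")
      case False
      with g(2) have "g x = f x" by (simp add: annihilator_def blinfun.bilinear_simps)
      with V(1) show ?thesis by (auto simp: PiE_iff)
    qed simp
    with V(3) U(2) have "g \<in> T" by (auto simp: PiE_iff)
    with g(1) show ?thesis by blast
  qed
  then show ?thesis
    unfolding set_eq_iff in_closure_of strong_operator_topology_topspace by blast
qed

lemma weak_star_closed_annihilator: "closedin weak_star_topology (annihilator S)"
proof -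
  have *: "closedin weak_star_topology {f. blinfun_apply f x = 0}" for x :: 'a
    using closedin_continuous_map_preimage[OF strong_operator_topology_continuous_evaluation[of x], of "{0}"]
    by (simp add: strong_operator_topology_topspace)
  \<comment> \<open>The index \<open>0\<close> contributes the whole dual and keeps the intersected
    family nonempty when \<open>S\<close> is empty.\<close>
  then have "closedin weak_star_topology (\<Inter>x\<in>insert 0 S. {f. blinfun_apply f x = 0})"
    using * by (intro closedin_Inter) (auto simp del: blinfun.zero_right)
  moreover have "annihilator S = (\<Inter>x\<in>insert 0 S. {f. blinfun_apply f x = 0})"
    by (auto simp: annihilator_def blinfun.bilinear_simps)
  ultimately show ?thesis by simp
qed

text \<open>Take representatives of a dense set of cosets, and for each a functional attaining the
  distance to \<open>Z\<close> there. For \<open>x\<close> outside \<open>Z\<close>, a coset closer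
  than half the distance of \<open>x\<close> to \<open>Z\<close> has a functional that cannot vanish
  at \<open>x\<close>.\<close>

lemma small_codens_functionals:
  fixes Z :: "'a::real_normed_vector set"
  assumes Z: "subspace Z" "closed Z"
  obtains F where "|F| \<le>o codens Z" "F \<subseteq> annihilator Z" "\<And>x. (\<And>f. f \<in> F \<Longrightarrow> blinfun_apply f x = 0) \<Longrightarrow> x \<in> Z"
proof -
  interpret Metric_space "cosets Z" setdist by (rule Metric_space_cosets[OF Z])
  obtain D where D: "dense_in mtopology D" "codens Z = |D|"
    using dens_attained[of "quotient_topology Z"] unfolding codens_def quotient_topology_def by metis
  have "D \<subseteq> cosets Z" using D(1) unfolding dense_in_def topspace_mtopology by blast
  then have "\<exists>w. C = (+) w ` Z" if "C \<in> D" for C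
    using that unfolding cosets_def by blast
  then obtain w where w: "\<And>C. C \<in> D \<Longrightarrow> C = (+) (w C) ` Z" by metis
  have "\<exists>f. f \<in> annihilator Z \<and> (\<forall>x. \<bar>blinfun_apply f x\<bar> \<le> infdist x Z) \<and> blinfun_apply f a = infdist a Z" for a
    by (rule Hahn_Banach_infdist[OF Z(1), of a]) blast
  then obtain f where f: "\<And>a. f a \<in> annihilator Z" "\<And>a x. \<bar>blinfun_apply (f a) x\<bar> \<le> infdist x Z"
    "\<And>a. blinfun_apply (f a) a = infdist a Z" by metis
  show thesis
  proof (rule that)
    show "|(\<lambda>C. f (w C)) ` D| \<le>o codens Z" unfolding D(2) by (rule card_of_image)
    show "(\<lambda>C. f (w C)) ` D \<subseteq> annihilator Z" using f(1) by blast
    fix x assume x: "\<And>g. g \<in> (\<lambda>C. f (w C)) ` D \<Longrightarrow> blinfun_apply g x = 0"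
    show "x \<in> Z"
    proof (rule ccontr)
      assume "x \<notin> Z"
      then have d: "infdist x Z > 0"
        using Z in_closed_iff_infdist_zero[OF Z(2), of x] subspace_0[OF Z(1)] infdist_nonneg[of x Z]
        by (metis empty_iff less_eq_real_def)
      have "(+) x ` Z \<in> mtopology closure_of D"
        using D(1) unfolding dense_in_def topspace_mtopology by (auto simp: cosets_def)
      then obtain C where C: "C \<in> D" "setdist ((+) x ` Z) C < infdist x Z / 2"
        using d unfolding metric_closure_of by (auto dest!: spec[of _ "infdist x Z / 2"])
      have "Inf (norm ` ((+) (x - w C) ` Z)) < infdist x Z / 2"
        using C(2) w[OF C(1)] setdist_cosets[OF Z(1), of x "w C"] by simp
      then obtain z where z: "z \<in> Z" "norm ((x - w C) + z) < infdist x Z / 2"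
        using subspace_0[OF Z(1)] by (subst (asm) cInf_less_iff) (auto intro!: bdd_belowI2[of _ 0])
      have "infdist (x - w C) Z \<le> norm ((x - w C) + z)"
        using infdist_le[OF subspace_neg[OF Z(1) z(1)], of "x - w C"] by (simp add: dist_norm)
      with z(2) have less: "infdist (x - w C) Z < infdist x Z / 2" by simp
      have "infdist x Z \<le> infdist (x - w C) Z + infdist (w C) Z"
        using sublinear_add[OF sublinear_infdist[OF Z(1)], of "x - w C" "w C"] by simp
      also have "infdist (w C) Z = f (w C) x - f (w C) (x - w C)"
        by (simp add: f(3) blinfun.bilinear_simps)
      also have "f (w C) x = 0" using x C(1) by blast
      finally show False using less f(2)[of "w C" "x - w C"] by linarith
    qed
  qed
qed

text \<open>Every \<open>f\<close> annihilating \<open>Y\<close> has \<open>f z = f (u + z)\<close>,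
  so no quotient in the supremum that equals \<open>norm z\<close> exceeds
  \<open>norm (u + z)\<close>. If the annihilator is trivial, \<open>z = 0\<close>.\<close>

lemma Psi_annihilator_norm_le:
  assumes "z \<in> Psi (annihilator Y)" "u \<in> Y"
  shows "norm z \<le> norm (u + z)"
proof (cases "annihilator Y \<subseteq> {0}")
  case True
  with assms show ?thesis by (simp add: Psi_def)
next
  case False
  then have "norm z = (SUP f\<in>annihilator Y - {0}. \<bar>blinfun_apply f z\<bar> / norm f)"
    using assms by (simp add: Psi_def)
  also have "\<dots> \<le> norm (u + z)"
  proof (rule cSUP_least)
    fix f assume f: "f \<in> annihilator Y - {0}"
    then have "f z = f (u + z)"
      using assms(2) by (simp add: annihilator_def blinfun.bilinear_simps)
    then show "\<bar>blinfun_apply f z\<bar> / norm f \<le> norm (u + z)"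
      using norm_blinfun[of f "u + z"] f by (simp add: field_simps)
  qed (use False in auto)
  finally show ?thesis .
qed

subsection \<open>Dispersed sequences of regular length\<close>

locale uncountable_regular =
  fixes \<kappa> :: "'i rel"
  assumes Card_order: "Card_order \<kappa>" and regular: "regularCard \<kappa>" and uncountable: "natLeq <o \<kappa>"
begin

lemma wo_rel: "wo_rel \<kappa>"
  using Card_order unfolding wo_rel_def by (rule card_order_on_well_order_on)

lemmas WELL = wo_rel.WELL[OF wo_rel]
  and REFL = wo_rel.REFL[OF wo_rel]
  and TRANS = wo_rel.TRANS[OF wo_rel]
  and ANTISYM = wo_rel.ANTISYM[OF wo_rel]
  and TOTALS = wo_rel.TOTALS[OF wo_rel]

lemma underS_le_trans: "a \<in> underS \<kappa> b \<Longrightarrow> (b, c) \<in> \<kappa> \<Longrightarrow> a \<in> underS \<kappa> c"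
  using transD[OF TRANS, of a b c] antisymD[OF ANTISYM, of a b] by (auto simp: underS_def)

lemma le_underS_trans: "(a, b) \<in> \<kappa> \<Longrightarrow> b \<in> underS \<kappa> c \<Longrightarrow> a \<in> underS \<kappa> c"
  using transD[OF TRANS, of a b c] antisymD[OF ANTISYM, of b c] by (auto simp: underS_def)

lemma underS_imp_le: "a \<in> underS \<kappa> b \<Longrightarrow> (a, b) \<in> \<kappa>"
  by (simp add: underS_def)

lemma aboveS_iff: "b \<in> aboveS \<kappa> a \<longleftrightarrow> a \<in> underS \<kappa> b"
  by (auto simp: aboveS_def underS_def)

lemma Cinfinite: "Cinfinite \<kappa>"
  using cinfinite_mono[OF ordLess_imp_ordLeq[OF uncountable] natLeq_cinfinite] Card_order by blast

lemma infinite_Field: "infinite (Field \<kappa>)"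
  using Cinfinite by (simp add: cinfinite_def)

lemma countable_ordLess: "countable A \<Longrightarrow> |A| <o \<kappa>"
proof -
  assume "countable A"
  then have "|A| \<le>o |UNIV :: nat set|"
    unfolding card_of_ordLeq[symmetric] countable_def by blast
  from ordLeq_ordLess_trans[OF ordLeq_ordIso_trans[OF this card_of_nat] uncountable]
  show "|A| <o \<kappa>" .
qed

lemma image_ordLess: "|A| <o \<kappa> \<Longrightarrow> |f ` A| <o \<kappa>"
  by (rule ordLeq_ordLess_trans[OF card_of_image])

lemma UNION_ordLess: "|I| <o \<kappa> \<Longrightarrow> (\<And>i. i \<in> I \<Longrightarrow> |A i| <o \<kappa>) \<Longrightarrow> |\<Union>i\<in>I. A i| <o \<kappa>"
  by (intro card_of_UNION_ordLess_infinite_Field_regularCard[OF regular Cinfinite] ballI)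

text \<open>By regularity \<open>K\<close> is not cofinal; its weak upper bound \<open>a\<close> is
  then raised to a strict one, as an infinite cardinal has no last element.\<close>

lemma ordLess_bounded:
  assumes "K \<subseteq> Field \<kappa>" "|K| <o \<kappa>"
  obtains b where "b \<in> Field \<kappa>" "K \<subseteq> underS \<kappa> b"
proof -
  have "\<not> cofinal K \<kappa>"
    using assms regular not_ordLess_ordIso unfolding regularCard_def by blast
  then obtain a where a: "a \<in> Field \<kappa>" "\<And>k. k \<in> K \<Longrightarrow> a = k \<or> (a, k) \<notin> \<kappa>"
    unfolding cofinal_def by blast
  then obtain b where b: "b \<in> Field \<kappa>" "a \<in> underS \<kappa> b"
    using infinite_Card_order_limit[OF Card_order infinite_Field a(1)] by (auto simp: underS_def)
  have "k \<in> underS \<kappa> b" if "k \<in> K" for k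
  proof (rule le_underS_trans[OF _ b(2)])
    show "(k, a) \<in> \<kappa>"
      using a that assms(1) TOTALS by blast
  qed
  with b(1) show thesis using that by blast
qed

text \<open>\<open>D\<close> consists of the rational combinations of vectors of \<open>S\<close>.
  They arise in countably many stages, each of size below \<open>\<kappa>\<close>, so regularity and
  uncountability bound the union.\<close>

lemma span_dense_ordLess:
  fixes S :: "'a::real_normed_vector set"
  assumes S: "|S| <o \<kappa>"
  obtains D where "|D| <o \<kappa>" "D \<subseteq> span S" "closed_span S \<subseteq> closure D"
proof -
  define step where "step E = (\<Union>q\<in>\<rat>. \<Union>s\<in>S. (\<lambda>d. q *\<^sub>R s + d) ` E)" for E :: "'a set"
  define D where "D = (\<Union>n. (step ^^ n) {0})"
  have small: "|(step ^^ n) {0}| <o \<kappa>" for n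
  proof (induction n)
    case 0
    show ?case by (simp add: countable_ordLess)
  next
    case (Suc n)
    show ?case
      unfolding funpow.simps o_apply step_def[of "(step ^^ n) {0}"]
      by (intro UNION_ordLess image_ordLess S countable_ordLess[OF countable_rat] Suc)
  qed
  have "(step ^^ n) {0} \<subseteq> span S" for n
  proof (induction n)
    case (Suc n)
    then show ?case
      by (auto simp: step_def[of "(step ^^ n) {0}"] intro!: span_add span_scale intro: span_base)
  qed (simp add: span_zero)
  then have D_span: "D \<subseteq> span S" by (auto simp: D_def)
  have D_step: "q *\<^sub>R s + d \<in> D" if "q \<in> \<rat>" "s \<in> S" "d \<in> D" for q s d
  proof -
    obtain n where "d \<in> (step ^^ n) {0}" using \<open>d \<in> D\<close> unfolding D_def by blast
    with that have "q *\<^sub>R s + d \<in> (step ^^ Suc n) {0}" by (auto simp: step_def)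
    then show ?thesis unfolding D_def by blast
  qed
  have "x \<in> closure D" if "x \<in> span S" for x
    using that
  proof (induction rule: span_induct_alt)
    case base
    have "0 \<in> (step ^^ 0) {0}" by simp
    then have "0 \<in> D" unfolding D_def by blast
    then show ?case using closure_subset by blast
  next
    case (step c s d)
    \<comment> \<open>Continuity passes from rational to real coefficients: the map sends
      \<open>\<rat> \<times> D\<close> into \<open>D\<close>, hence the closure into
      \<open>closure D\<close>.\<close>
    have "(\<lambda>(q, d). q *\<^sub>R s + d) ` closure (\<rat> \<times> D) \<subseteq> closure D"
      using D_step[OF _ step(1)] closure_subset
      by (intro image_closure_subset) (force simp: case_prod_unfold intro!: continuous_intros)+
    then show ?case
      using step(2) by (force simp: closure_Times Rats_closure_real)
  qed
  then have "closed_span S \<subseteq> closure D"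
    unfolding closed_span_def by (intro closure_minimal) auto
  moreover have "|D| <o \<kappa>"
    unfolding D_def by (intro UNION_ordLess small countable_ordLess) auto
  ultimately show thesis using that D_span by blast
qed

lemma dens_closed_span_ordLess:
  fixes S :: "'a::real_normed_vector set"
  assumes S: "|S| <o \<kappa>"
  shows "dens (top_of_set (closed_span S)) <o \<kappa>"
proof -
  obtain D where D: "|D| <o \<kappa>" "D \<subseteq> span S" "closed_span S \<subseteq> closure D"
    using span_dense_ordLess[OF S] by blast
  have sub: "D \<subseteq> closed_span S"
    using D(2) closure_subset unfolding closed_span_def by blast
  then have "dense_in (top_of_set (closed_span S)) D"
    using D(3) by (simp add: dense_in_def closure_of_subtopology Int_absorb1 Int_absorb2)
  then have "dens (top_of_set (closed_span S)) \<le>o |D|"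
    by (metis dens_attained)
  then show ?thesis using D(1) ordLeq_ordLess_trans by blast
qed

end

section \<open>Tails of a strongly dispersed sequence\<close>

locale dispersed_sequence = uncountable_regular \<kappa>
  for \<kappa> :: "'i rel" +
  fixes y :: "'i \<Rightarrow> 'a::real_normed_vector"
  assumes property_C: "property_C TYPE('a)"
    and dispersed: "strongly_dispersed \<kappa> y"
begin

lemma aboveS_antimono: "(\<mu>, \<nu>) \<in> \<kappa> \<Longrightarrow> aboveS \<kappa> \<nu> \<subseteq> aboveS \<kappa> \<mu>"
  using le_underS_trans by (auto simp: aboveS_iff)

text \<open>The tail annihilators form an increasing chain of weak-star closed subspaces with weak-star
  dense union. By property (C), each functional lies in the closed convex hull of countably many
  members of this union, which by regularity all lie in one member of the chain.\<close>

proposition eventually_annihilated: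
  obtains \<nu> where "\<nu> \<in> Field \<kappa>" "f \<in> annihilator (y ` aboveS \<kappa> \<nu>)"
proof -
  let ?A = "\<lambda>\<nu>. annihilator (y ` aboveS \<kappa> \<nu>)"
  let ?\<Gamma> = "\<Union>\<nu>\<in>Field \<kappa>. ?A \<nu>"
  have mono: "?A \<mu> \<subseteq> ?A \<nu>" if "(\<mu>, \<nu>) \<in> \<kappa>" for \<mu> \<nu>
    by (intro annihilator_mono image_mono aboveS_antimono that)
  obtain \<nu>0 where \<nu>0: "\<nu>0 \<in> Field \<kappa>" using infinite_Field by fastforce
  have "subspace ?\<Gamma>"
  proof (rule subspaceI)
    show "0 \<in> ?\<Gamma>" using \<nu>0 subspace_0[OF subspace_annihilator] by blast
    show "c *\<^sub>R g \<in> ?\<Gamma>" if "g \<in> ?\<Gamma>" for c g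
      using that subspace_scale[OF subspace_annihilator] by blast
    fix g h assume "g \<in> ?\<Gamma>" "h \<in> ?\<Gamma>"
    then obtain \<mu> \<nu> where "\<mu> \<in> Field \<kappa>" "\<nu> \<in> Field \<kappa>" "g \<in> ?A \<mu>" "h \<in> ?A \<nu>" by blast
    moreover from this have "(\<mu>, \<nu>) \<in> \<kappa> \<or> (\<nu>, \<mu>) \<in> \<kappa>" using TOTALS by blast
    ultimately obtain \<xi> where "\<xi> \<in> Field \<kappa>" "g \<in> ?A \<xi>" "h \<in> ?A \<xi>" using mono by blast
    then show "g + h \<in> ?\<Gamma>" using subspace_add[OF subspace_annihilator] by blast
  qed
  \<comment> \<open>Strong dispersal gives a tail whose closed span misses \<open>x\<close>; a
    functional attaining the distance from \<open>x\<close> to that span annihilates the tail but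
    not \<open>x\<close>.\<close>
  moreover have "\<exists>g\<in>?\<Gamma>. blinfun_apply g x \<noteq> 0" if "x \<noteq> 0" for x
  proof -
    obtain \<nu> where \<nu>: "\<nu> \<in> Field \<kappa>" "x \<notin> closed_span (y ` aboveS \<kappa> \<nu>)"
      using dispersed \<open>x \<noteq> 0\<close> unfolding strongly_dispersed_def by blast
    obtain g where g: "g \<in> annihilator (closed_span (y ` aboveS \<kappa> \<nu>))"
      "blinfun_apply g x = infdist x (closed_span (y ` aboveS \<kappa> \<nu>))"
      using Hahn_Banach_infdist[OF subspace_closed_span] by blast
    have "g x \<noteq> 0"
      using \<nu>(2) in_closed_iff_infdist_zero[OF closed_closed_span] subspace_0[OF subspace_closed_span]
      unfolding g(2) by blast
    with \<nu>(1) g(1) show ?thesis by auto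
  qed
  ultimately have "f \<in> weak_star_topology closure_of ?\<Gamma>"
    using separating_subspace_weak_star_dense by blast
  then obtain \<Gamma>0 where \<Gamma>0: "\<Gamma>0 \<subseteq> ?\<Gamma>" "countable \<Gamma>0"
    "f \<in> weak_star_topology closure_of (convex hull \<Gamma>0)"
    using property_C unfolding property_C_def by meson
  from \<Gamma>0(1) have "\<forall>g\<in>\<Gamma>0. \<exists>\<nu>. \<nu> \<in> Field \<kappa> \<and> g \<in> ?A \<nu>" by blast
  then obtain n where n: "\<And>g. g \<in> \<Gamma>0 \<Longrightarrow> n g \<in> Field \<kappa> \<and> g \<in> ?A (n g)" by metis
  then obtain \<nu> where \<nu>: "\<nu> \<in> Field \<kappa>" "n ` \<Gamma>0 \<subseteq> underS \<kappa> \<nu>"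
    using ordLess_bounded[of "n ` \<Gamma>0"] image_ordLess countable_ordLess \<Gamma>0(2) by blast
  have "g \<in> ?A \<nu>" if "g \<in> \<Gamma>0" for g
  proof -
    have "(n g, \<nu>) \<in> \<kappa>" using \<nu>(2) that unfolding underS_def by blast
    with mono n that show ?thesis by blast
  qed
  then have "convex hull \<Gamma>0 \<subseteq> ?A \<nu>"
    by (intro hull_minimal subspace_imp_convex subspace_annihilator) blast
  then have "weak_star_topology closure_of (convex hull \<Gamma>0) \<subseteq> ?A \<nu>"
    by (rule closure_of_minimal[OF _ weak_star_closed_annihilator])
  with \<Gamma>0(3) \<nu>(1) show thesis using that by blast
qed

text \<open>Each functional has its own tail, and by regularity fewer than \<open>\<kappa>\<close>
  starting indices have a common upper bound.\<close>

corollary eventually_annihilated_family: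
  fixes F :: "('a \<Rightarrow>\<^sub>L real) set"
  assumes "|F| <o \<kappa>"
  obtains \<nu> where "\<nu> \<in> Field \<kappa>" "F \<subseteq> annihilator (y ` aboveS \<kappa> \<nu>)"
proof -
  have "\<exists>\<nu>. \<nu> \<in> Field \<kappa> \<and> f \<in> annihilator (y ` aboveS \<kappa> \<nu>)" for f
    using eventually_annihilated by blast
  then obtain n where n: "\<And>f. n f \<in> Field \<kappa>" "\<And>f. f \<in> annihilator (y ` aboveS \<kappa> (n f))" by metis
  then obtain \<nu> where \<nu>: "\<nu> \<in> Field \<kappa>" "n ` F \<subseteq> underS \<kappa> \<nu>"
    using ordLess_bounded[of "n ` F"] image_ordLess assms by blast
  have "f \<in> annihilator (y ` aboveS \<kappa> \<nu>)" if "f \<in> F" for f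
  proof -
    have "(n f, \<nu>) \<in> \<kappa>" using \<nu>(2) that unfolding underS_def by blast
    then show ?thesis using annihilator_mono[OF image_mono[OF aboveS_antimono]] n(2) by blast
  qed
  with \<nu>(1) show thesis using that by blast
qed

text \<open>One half of bimonotonicity. If a norming functional of \<open>d\<close> vanishes at
  \<open>z\<close>, its value at \<open>d + z\<close> is still \<open>norm d\<close>; the resulting
  inequality is closed in \<open>d\<close> and so extends from \<open>D\<close> to its
  closure.\<close>

lemma tail_norm_le:
  fixes D :: "'a set"
  assumes "|D| <o \<kappa>"
  obtains \<nu> where "\<nu> \<in> Field \<kappa>"
    "\<And>u z. u \<in> closure D \<Longrightarrow> z \<in> closed_span (y ` aboveS \<kappa> \<nu>) \<Longrightarrow> norm u \<le> norm (u + z)"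
proof -
  have "\<exists>f :: 'a \<Rightarrow>\<^sub>L real. (\<forall>x. \<bar>f x\<bar> \<le> norm x) \<and> f u = norm u" for u
    by (rule Hahn_Banach_infdist[OF subspace_single_0, of u]) (auto simp: infdist_singleton dist_norm)
  then obtain f :: "'a \<Rightarrow> 'a \<Rightarrow>\<^sub>L real"
    where f: "\<And>u x. \<bar>f u x\<bar> \<le> norm x" "\<And>u. f u u = norm u" by metis
  obtain \<nu> where \<nu>: "\<nu> \<in> Field \<kappa>" "f ` D \<subseteq> annihilator (y ` aboveS \<kappa> \<nu>)"
    using eventually_annihilated_family image_ordLess assms by blast
  show thesis
  proof (rule that[OF \<nu>(1)])
    fix u z assume u: "u \<in> closure D" and z: "z \<in> closed_span (y ` aboveS \<kappa> \<nu>)"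
    have "norm d \<le> norm (d + z)" if "d \<in> D" for d
    proof -
      have "f d \<in> annihilator (closed_span (y ` aboveS \<kappa> \<nu>))" using \<nu>(2) that by auto
      then have "f d z = 0" using z unfolding annihilator_def by blast
      then have "norm d = f d (d + z)" by (simp add: f(2) blinfun.bilinear_simps)
      then show ?thesis using f(1)[of d "d + z"] by linarith
    qed
    moreover have "closed {d. norm d \<le> norm (d + z)}"
      by (intro closed_Collect_le continuous_intros)
    ultimately show "norm u \<le> norm (u + z)"
      using u closure_minimal[of D "{d. norm d \<le> norm (d + z)}"] by blast
  qed
qed

lemma tail_nonempty: "\<nu> \<in> Field \<kappa> \<Longrightarrow> \<exists>\<alpha>\<in>Field \<kappa>. \<alpha> \<in> aboveS \<kappa> \<nu>"
  using infinite_Card_order_limit[OF Card_order infinite_Field] by (fastforce simp: aboveS_def)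

text \<open>A dense set of size below \<open>\<kappa>\<close> would give
  \<open>norm u \<le> norm (u + z)\<close> for every vector \<open>u\<close> and every
  \<open>z\<close> in some tail, which fails for \<open>u = - z\<close> with \<open>z\<close> a unit
  vector.\<close>

lemma dens_ge:
  assumes y: "y ` Field \<kappa> \<subseteq> sphere 0 1"
  shows "\<kappa> \<le>o dens (euclidean :: 'a topology)"
proof (rule ccontr)
  assume contra: "\<not> \<kappa> \<le>o dens (euclidean :: 'a topology)"
  obtain D where D: "dense_in (euclidean :: 'a topology) D" "dens (euclidean :: 'a topology) = |D|"
    by (rule dens_attained) blast
  have "|D| <o \<kappa>"
    using contra D(2) not_ordLess_iff_ordLeq[OF WELL card_of_Well_order] by metis
  then obtain \<nu> where \<nu>: "\<nu> \<in> Field \<kappa>"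
    "\<And>u z. u \<in> closure D \<Longrightarrow> z \<in> closed_span (y ` aboveS \<kappa> \<nu>) \<Longrightarrow> norm u \<le> norm (u + z)"
    using tail_norm_le by blast
  obtain \<alpha> where \<alpha>: "\<alpha> \<in> Field \<kappa>" "\<alpha> \<in> aboveS \<kappa> \<nu>" using tail_nonempty \<nu>(1) by blast
  have "y \<alpha> \<in> span (y ` aboveS \<kappa> \<nu>)" using \<alpha>(2) by (intro span_base imageI)
  then have "y \<alpha> \<in> closed_span (y ` aboveS \<kappa> \<nu>)"
    unfolding closed_span_def by (rule subsetD[OF closure_subset])
  moreover have "closure D = UNIV" using D(1) by (simp add: dense_in_def)
  ultimately have "norm (- y \<alpha>) \<le> norm (- y \<alpha> + y \<alpha>)" by (intro \<nu>(2)) auto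
  with y \<alpha>(1) show False by auto
qed

end

section \<open>Choice of the subsequence\<close>

locale dispersed_sphere_sequence = dispersed_sequence \<kappa> y
  for \<kappa> :: "'i rel" and y :: "'i \<Rightarrow> 'a::banach" +
  assumes sphere: "y ` Field \<kappa> \<subseteq> sphere 0 1"
    and dd: "condition_dd TYPE('a)"
begin

text \<open>The condition on the next index \<open>\<beta>\<close> once the indices in
  \<open>S\<close> are chosen. The tail runs through all of \<open>above \<kappa> \<beta>\<close>,
  so it covers any later choices in advance.\<close>

definition bimonotone_split :: "'i set \<Rightarrow> 'i \<Rightarrow> bool" where
  "bimonotone_split S \<beta> \<longleftrightarrow> \<beta> \<in> Field \<kappa> \<and> S \<subseteq> underS \<kappa> \<beta> \<and>
     (\<forall>u\<in>closed_span (y ` S). \<forall>z\<in>closed_span (y ` above \<kappa> \<beta>).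
        norm u \<le> norm (u + z) \<and> norm z \<le> norm (u + z))"

text \<open>As \<open>S\<close> is small, \<open>?Y\<close> has density below
  \<open>\<kappa>\<close>, hence by \<open>dens_ge\<close> below that of the space, and (d-d)
  applies to it.\<close>

lemma bimonotone_split_ex:
  assumes S: "S \<subseteq> Field \<kappa>" "|S| <o \<kappa>"
  shows "\<exists>\<beta>. bimonotone_split S \<beta>"
proof -
  let ?Y = "closed_span (y ` S)"
  have small: "|y ` S| <o \<kappa>" using S(2) by (rule image_ordLess)
  then have dens: "dens (top_of_set ?Y) <o \<kappa>" by (rule dens_closed_span_ordLess)
  then have "dens (top_of_set ?Y) <o dens (euclidean :: 'a topology)"
    using dens_ge[OF sphere] ordLess_ordLeq_trans by blast
  then obtain Z where Z: "closed Z" "subspace Z" "Z \<subseteq> Psi (annihilator ?Y)"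
    "codens Z \<le>o dens (top_of_set ?Y)"
    using dd subspace_closed_span closed_closed_span unfolding condition_dd_def by meson
  obtain F where F: "|F| \<le>o codens Z" "F \<subseteq> annihilator Z"
    "\<And>x. (\<And>f. f \<in> F \<Longrightarrow> blinfun_apply f x = 0) \<Longrightarrow> x \<in> Z"
    using small_codens_functionals[OF Z(2,1)] by blast
  have "|F| <o \<kappa>"
    using F(1) Z(4) dens ordLeq_ordLess_trans ordLeq_transitive by blast
  then obtain \<mu> where \<mu>: "\<mu> \<in> Field \<kappa>" "F \<subseteq> annihilator (closed_span (y ` aboveS \<kappa> \<mu>))"
    using eventually_annihilated_family by auto
  \<comment> \<open>\<open>Z\<close> contains the common kernel of \<open>F\<close>, so a tail on
    which all of \<open>F\<close> vanishes has its closed span in \<open>Z\<close>.\<close>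
  have tail_Z: "closed_span (y ` aboveS \<kappa> \<mu>) \<subseteq> Z"
    using F(3) \<mu>(2) unfolding annihilator_def by blast
  obtain D where D: "|D| <o \<kappa>" "?Y \<subseteq> closure D"
    by (rule span_dense_ordLess[OF small])
  obtain \<nu> where \<nu>: "\<nu> \<in> Field \<kappa>"
    "\<And>u z. u \<in> closure D \<Longrightarrow> z \<in> closed_span (y ` aboveS \<kappa> \<nu>) \<Longrightarrow> norm u \<le> norm (u + z)"
    using tail_norm_le[OF D(1)] by blast
  obtain \<sigma> where \<sigma>: "\<sigma> \<in> Field \<kappa>" "S \<subseteq> underS \<kappa> \<sigma>"
    using ordLess_bounded[OF S] by blast
  \<comment> \<open>Being strictly beyond \<open>\<mu>\<close> and \<open>\<nu>\<close>, the tail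
    from \<open>\<beta>\<close> on, \<open>\<beta>\<close> included, inherits both norm
    inequalities; being beyond \<open>\<sigma>\<close> places \<open>\<beta>\<close> after
    \<open>S\<close>.\<close>
  obtain \<beta> where \<beta>: "\<beta> \<in> Field \<kappa>" "{\<mu>, \<nu>, \<sigma>} \<subseteq> underS \<kappa> \<beta>"
    using ordLess_bounded[of "{\<mu>, \<nu>, \<sigma>}"] \<mu>(1) \<nu>(1) \<sigma>(1) countable_ordLess[of "{\<mu>, \<nu>, \<sigma>}"] by auto
  have "above \<kappa> \<beta> \<subseteq> aboveS \<kappa> \<xi>" if "\<xi> \<in> underS \<kappa> \<beta>" for \<xi>
    using underS_le_trans[OF that] by (auto simp: aboveS_iff above_def)
  then have tail: "closed_span (y ` above \<kappa> \<beta>) \<subseteq> closed_span (y ` aboveS \<kappa> \<xi>)"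
    if "\<xi> \<in> underS \<kappa> \<beta>" for \<xi>
    using that by (intro closed_span_mono image_mono)
  have "S \<subseteq> underS \<kappa> \<beta>"
    using \<sigma>(2) \<beta>(2) underS_le_trans underS_imp_le by blast
  moreover have "norm u \<le> norm (u + z) \<and> norm z \<le> norm (u + z)"
    if u: "u \<in> ?Y" and z: "z \<in> closed_span (y ` above \<kappa> \<beta>)" for u z
  proof
    show "norm u \<le> norm (u + z)"
      using u z D(2) tail[of \<nu>] \<beta>(2) by (intro \<nu>(2)) auto
    have "z \<in> Psi (annihilator ?Y)"
      using z tail[of \<mu>] \<beta>(2) tail_Z Z(3) by blast
    with u show "norm z \<le> norm (u + z)" by (rule Psi_annihilator_norm_le[rotated])
  qed
  ultimately show ?thesis using \<beta>(1) unfolding bimonotone_split_def by blast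
qed

lemma bimonotone_subsequence_ex:
  "\<exists>a. strictly_increasing \<kappa> a \<and> bimonotone_basic \<kappa> (y \<circ> a)"
proof -
  \<comment> \<open>The choice depends on the earlier values alone, which makes the recursion
    admissible. It is arbitrary where no split exists, a case that \<open>split\<close> below
    excludes.\<close>
  define H where "H a \<eta> = (SOME \<beta>. bimonotone_split (a ` underS \<kappa> \<eta>) \<beta>)" for a :: "'i \<Rightarrow> 'i" and \<eta>
  define a where "a = wo_rel.worec \<kappa> H"
  have "wo_rel.adm_wo \<kappa> H"
    unfolding wo_rel.adm_wo_def[OF wo_rel]
  proof (intro allI impI)
    fix f g :: "'i \<Rightarrow> 'i" and x assume "\<forall>y\<in>underS \<kappa> x. f y = g y"
    then have "f ` underS \<kappa> x = g ` underS \<kappa> x" by auto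
    then show "H f x = H g x" by (simp add: H_def)
  qed
  then have rec: "a \<eta> = (SOME \<beta>. bimonotone_split (a ` underS \<kappa> \<eta>) \<beta>)" for \<eta>
    unfolding a_def by (subst wo_rel.worec_fixpoint[OF wo_rel]) (simp_all add: H_def)
  \<comment> \<open>A next index exists once the earlier ones lie in \<open>Field \<kappa>\<close>,
    which the induction hypothesis supplies; they are fewer than \<open>\<kappa>\<close> because
    \<open>\<kappa>\<close> is a cardinal.\<close>
  have split: "\<eta> \<in> Field \<kappa> \<longrightarrow> bimonotone_split (a ` underS \<kappa> \<eta>) (a \<eta>)" for \<eta>
  proof (induction \<eta> rule: wo_rel.well_order_induct[OF wo_rel])
    case (1 \<eta>)
    show ?case
    proof
      assume \<eta>: "\<eta> \<in> Field \<kappa>"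
      have "a \<delta> \<in> Field \<kappa>" if "\<delta> \<in> underS \<kappa> \<eta>" for \<delta>
        using 1 that unfolding underS_def bimonotone_split_def by (auto simp: Field_def)
      moreover have "|a ` underS \<kappa> \<eta>| <o \<kappa>"
        using card_of_underS[OF Card_order \<eta>] by (rule image_ordLess)
      ultimately have "\<exists>\<beta>. bimonotone_split (a ` underS \<kappa> \<eta>) \<beta>"
        by (intro bimonotone_split_ex) auto
      then show "bimonotone_split (a ` underS \<kappa> \<eta>) (a \<eta>)"
        unfolding rec[of \<eta>] by (rule someI_ex)
    qed
  qed
  then have Field: "a \<eta> \<in> Field \<kappa>" if "\<eta> \<in> Field \<kappa>" for \<eta>
    using that unfolding bimonotone_split_def by blast
  have mono: "a \<gamma> \<noteq> a \<delta> \<and> (a \<gamma>, a \<delta>) \<in> \<kappa>" if "\<gamma> \<noteq> \<delta>" "(\<gamma>, \<delta>) \<in> \<kappa>" for \<gamma> \<delta>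
  proof -
    have "\<gamma> \<in> underS \<kappa> \<delta>" "\<delta> \<in> Field \<kappa>" using that by (auto simp: underS_def Field_def)
    then have "a \<gamma> \<in> underS \<kappa> (a \<delta>)"
      using split[of \<delta>] unfolding bimonotone_split_def by blast
    then show ?thesis by (simp add: underS_def)
  qed
  have "strictly_increasing \<kappa> a"
    unfolding strictly_increasing_def monotone_on_def using Field mono by auto
  moreover have "bimonotone_basic \<kappa> (y \<circ> a)"
    unfolding bimonotone_basic_def
  proof (intro conjI ballI)
    fix \<gamma> assume "\<gamma> \<in> Field \<kappa>"
    with Field sphere have "y (a \<gamma>) \<in> sphere 0 1" by blast
    then show "(y \<circ> a) \<gamma> \<noteq> 0" by auto
  next
    fix \<eta> u z
    assume \<eta>: "\<eta> \<in> Field \<kappa>" and u: "u \<in> closed_span ((y \<circ> a) ` underS \<kappa> \<eta>)"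
      and z: "z \<in> closed_span ((y \<circ> a) ` above \<kappa> \<eta>)"
    \<comment> \<open>The subsequence from position \<open>\<eta>\<close> on stays inside the tail
      of \<open>y\<close> from index \<open>a \<eta>\<close>, where the split at
      \<open>a \<eta>\<close> gives both inequalities.\<close>
    have "a ` above \<kappa> \<eta> \<subseteq> above \<kappa> (a \<eta>)"
    proof
      fix \<beta> assume "\<beta> \<in> a ` above \<kappa> \<eta>"
      then obtain \<gamma> where "(\<eta>, \<gamma>) \<in> \<kappa>" "\<beta> = a \<gamma>" by (auto simp: above_def)
      then show "\<beta> \<in> above \<kappa> (a \<eta>)"
        using mono[of \<eta> \<gamma>] refl_onD[OF REFL Field[OF \<eta>]] unfolding above_def by blast
    qed
    then have "z \<in> closed_span (y ` above \<kappa> (a \<eta>))"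
      using z closed_span_mono[of "(y \<circ> a) ` above \<kappa> \<eta>" "y ` above \<kappa> (a \<eta>)"] by (auto simp: image_comp[symmetric])
    moreover have "u \<in> closed_span (y ` (a ` underS \<kappa> \<eta>))" using u by (simp add: image_comp)
    ultimately show "norm u \<le> norm (u + z)" "norm z \<le> norm (u + z)"
      using split[of \<eta>] \<eta> unfolding bimonotone_split_def by blast+
  qed
  ultimately show ?thesis by blast
qed

end

theorem theorem5p3:
  fixes \<kappa> :: "'i rel" and y :: "'i \<Rightarrow> 'a::banach"
  assumes "WLD TYPE('a)"
    and "condition_dd TYPE('a)"
    and "Card_order \<kappa>" and "regularCard \<kappa>" and "natLeq <o \<kappa>"
    and "y ` Field \<kappa> \<subseteq> sphere 0 1"
    and "strongly_dispersed \<kappa> y"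
  shows "\<exists>a. strictly_increasing \<kappa> a \<and> bimonotone_basic \<kappa> (y \<circ> a)"
proof -
  interpret dispersed_sphere_sequence \<kappa> y
    using assms by unfold_locales (auto simp: WLD_def)
  show ?thesis by (rule bimonotone_subsequence_ex)
qed

end
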